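(* Let $d = d(n) \ge 1$ be an integer-valued function with $d(n) = o(\log n)$ as $n \to \infty$. Then for every sufficiently large $n$ there exist $m = m(n)$ and a set $X = X_n \subset \mathbb{R}^m$ with $|X| = n$, whose doubling dimension is $\Theta(\log n)$, and there is a sequence $\delta_n \to 0$, such that, with $G : \mathbb{R}^m \to \mathbb{R}^{d}$ a random projection, $M$ the minimum spanning tree cost of $X$ and $\widetilde{M}$ the minimum spanning tree cost of $GX$, with probability at least $2/3$ over $G$ we have $\widetilde{M} \le \delta_n \cdot M$ (i.e. $\widetilde{M} = o(1) \cdot M$).
   Context: All norms are Euclidean. The minimum spanning tree cost of a finite point set $Y$ in a Euclidean space is the minimum over spanning trees $T$ on $Y$ of $\sum_{(x,y)\in T}\|x-y\|$. $GX = \{Gx : x\in X\}$. Doubling dimension: for $x \in X$, $r > 0$ let $B(x,r) = \{y \in X : \|x-y\| \le r\}$. The doubling constant $\lambda_X$ is the smallest $\lambda$ such that for all $x \in X$, $r > 0$ there is $S \subseteq X$ with $|S| \le \lambda$ and $B(x,r) \subseteq \bigcup_{s \in S} B(s, r/2)$. The doubling dimension is $d_X = \log_2 \lambda_X$. A random projection from $\mathbb{R}^m$ to $\mathbb{R}^d$ is a random linear map $G$ given by a $d \times m$ matrix with i.i.d. entries drawn from $\mathcal{N}(0, 1/d)$ (variance $1/d$). *)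

theory Defs
  imports "HOL-Probability.Probability" "HOL-Library.Landau_Symbols"
begin

text \<open>The dimension varies with \<open>n\<close>, so points of \<open>\<real>\<^sup>m\<close> are the extensional functions in
  \<open>{..<m} \<rightarrow>\<^sub>E UNIV\<close>; extensionality makes equality and cardinality those of \<open>\<real>\<^sup>m\<close>.\<close>

definition eucl_space :: "nat \<Rightarrow> (nat \<Rightarrow> real) set" where
  "eucl_space m = {..<m} \<rightarrow>\<^sub>E UNIV"

definition eucl_dist :: "nat \<Rightarrow> (nat \<Rightarrow> real) \<Rightarrow> (nat \<Rightarrow> real) \<Rightarrow> real" where
  "eucl_dist m x y = L2_set (\<lambda>i. x i - y i) {..<m}"

definition ball_in :: "nat \<Rightarrow> (nat \<Rightarrow> real) set \<Rightarrow> (nat \<Rightarrow> real) \<Rightarrow> real \<Rightarrow> (nat \<Rightarrow> real) set" where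
  "ball_in m X x r = {y \<in> X. eucl_dist m x y \<le> r}"

definition doubling_constant :: "nat \<Rightarrow> (nat \<Rightarrow> real) set \<Rightarrow> nat" where
  "doubling_constant m X =
     (LEAST k. \<forall>x\<in>X. \<forall>r>0. \<exists>S\<subseteq>X. finite S \<and> card S \<le> k \<and>
        ball_in m X x r \<subseteq> (\<Union>s\<in>S. ball_in m X s (r / 2)))"

definition doubling_dimension :: "nat \<Rightarrow> (nat \<Rightarrow> real) set \<Rightarrow> real" where
  "doubling_dimension m X = log 2 (real (doubling_constant m X))"

text \<open>An undirected simple graph is a symmetric, irreflexive relation \<open>T\<close>. Cycles have at least
  three vertices: going back and forth along one edge does not count as a cycle.\<close>

definition has_cycle :: "('a \<times> 'a) set \<Rightarrow> bool" where
  "has_cycle T \<longleftrightarrow> (\<exists>p. length p \<ge> 3 \<and> distinct p \<and>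
     successively (\<lambda>u v. (u, v) \<in> T) p \<and> (last p, hd p) \<in> T)"

definition spanning_tree :: "'a set \<Rightarrow> ('a \<times> 'a) set \<Rightarrow> bool" where
  "spanning_tree Y T \<longleftrightarrow> T \<subseteq> Y \<times> Y \<and> sym T \<and> irrefl T \<and>
     (\<forall>x\<in>Y. \<forall>y\<in>Y. (x, y) \<in> T\<^sup>*) \<and> \<not> has_cycle T"

text \<open>Every undirected edge contributes two pairs to \<open>T\<close>, hence the factor one half.\<close>

definition tree_cost :: "nat \<Rightarrow> ((nat \<Rightarrow> real) \<times> (nat \<Rightarrow> real)) set \<Rightarrow> real" where
  "tree_cost m T = (\<Sum>(x, y)\<in>T. eucl_dist m x y) / 2"

definition mst_cost :: "nat \<Rightarrow> (nat \<Rightarrow> real) set \<Rightarrow> real" where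
  "mst_cost m Y = Min (tree_cost m ` {T. spanning_tree Y T})"

text \<open>The law of a \<open>d \<times> m\<close> matrix with i.i.d. centred Gaussian entries of variance \<open>1/d\<close>;
  the second argument of \<^const>\<open>normal_density\<close> is the standard deviation.\<close>

definition random_projection :: "nat \<Rightarrow> nat \<Rightarrow> (nat \<times> nat \<Rightarrow> real) measure" where
  "random_projection d m =
     (\<Pi>\<^sub>M _\<in>{..<d} \<times> {..<m}. density lborel (\<lambda>x. ennreal (normal_density 0 (sqrt (1 / real d)) x)))"

definition mat_apply :: "nat \<Rightarrow> nat \<Rightarrow> (nat \<times> nat \<Rightarrow> real) \<Rightarrow> (nat \<Rightarrow> real) \<Rightarrow> (nat \<Rightarrow> real)" where
  "mat_apply d m G x = (\<lambda>i\<in>{..<d}. \<Sum>j<m. G (i, j) * x j)"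

end

theory Submission
  imports Defs
begin

text \<open>Take \<open>X\<close> to be the standard basis of \<open>\<real>\<^sup>n\<close>. It is equidistant, so its doubling constant is \<open>n\<close>,
  and every spanning tree costs at least \<open>n / sqrt 2\<close> because every vertex has an edge. Its image
  consists of the columns of the matrix, whose squared norms sum to at most \<open>3n\<close> with probability at
  least \<open>2/3\<close> by Markov's inequality. Such points have a cheap spanning tree: those in the ball of
  radius \<open>R\<close> fall into at most \<open>C(R)\<^sup>d = n\<^sup>o\<^sup>(\<^sup>1\<^sup>)\<close> grid cells of diameter \<open>1/R\<close> and cost \<open>1/R\<close> each, apart
  from one per cell; those outside the ball cost at most \<open>2/R\<close> times their squared norm. Now let \<open>R\<close>
  grow slowly.\<close>

section \<open>Spanning trees under injective maps and under adding a leaf\<close>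

text \<open>Rotating the cycle so that \<open>v\<close> comes first leaves a rest
  \<open>bs @ as\<close> of at least two distinct vertices, whose two ends are the neighbours of
  \<open>v\<close>. It serves to show that a leaf lies on no cycle and that all vertices of a cycle
  are endpoints of edges.\<close>

lemma cycle_neighbours:
  assumes "length p \<ge> 3" "distinct p" "successively (\<lambda>u v. (u, v) \<in> T) p"
    and "(last p, hd p) \<in> T" and v: "v \<in> set p"
  obtains u w where "u \<noteq> w" "(u, v) \<in> T" "(v, w) \<in> T"
proof -
  obtain as bs where p: "p = as @ v # bs"
    using v by (auto simp: in_set_conv_decomp)
  let ?q = "bs @ as"
  have len: "length ?q \<ge> 2" and dist: "distinct ?q"
    using assms(1,2) by (auto simp: p)
  have "last ?q \<noteq> hd ?q"
  proof -
    obtain a b q where "?q = a # b # q"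
      using len by (metis Suc_le_length_iff numeral_2_eq_2)
    then show ?thesis
      using dist by (metis distinct.simps(2) last.simps last_in_set list.sel(1) list.distinct(1))
  qed
  moreover have "(v, hd ?q) \<in> T"
    using assms(1,3,4) by (cases bs; cases as) (auto simp: p successively_append_iff successively_Cons)
  moreover have "(last ?q, v) \<in> T"
    using assms(1,3,4) by (cases as; cases bs) (auto simp: p successively_append_iff successively_Cons)
  ultimately show thesis
    using that by blast
qed

text \<open>Paths push forward along \<open>f\<close>, while a cycle in the image pulls back along
  the inverse of \<open>f\<close> to a cycle in \<open>T\<close>.\<close>

lemma spanning_tree_image:
  assumes inj: "inj_on f S" and T: "spanning_tree S T"
  shows "spanning_tree (f ` S) (map_prod f f ` T)"
proof -
  let ?T = "map_prod f f ` T"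
  let ?g = "inv_into S f"
  have TS: "T \<subseteq> S \<times> S"
    using T by (simp add: spanning_tree_def)
  have "\<not> has_cycle ?T"
  proof
    assume "has_cycle ?T"
    then obtain p where p: "length p \<ge> 3" "distinct p"
      "successively (\<lambda>u v. (u, v) \<in> ?T) p" "(last p, hd p) \<in> ?T"
      unfolding has_cycle_def by metis
    have pull: "(?g u, ?g v) \<in> T" if "(u, v) \<in> ?T" for u v
      using that TS inj by auto
    \<comment> \<open>\<open>inv_into S f\<close> is injective only on the image of
      \<open>S\<close>, so the cycle has to be located there before it is pulled back.\<close>
    have "set p \<subseteq> f ` S"
    proof
      fix v assume "v \<in> set p"
      then obtain u where "(u, v) \<in> ?T"
        using cycle_neighbours[OF p] by metis
      then show "v \<in> f ` S"
        using TS by auto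
    qed
    then have "distinct (map ?g p)"
      using p(2) by (auto simp: distinct_map intro: inj_on_subset[OF inj_on_inv_into])
    moreover have "successively (\<lambda>u v. (u, v) \<in> T) (map ?g p)"
      unfolding successively_map by (rule successively_mono[OF p(3)]) (rule pull)
    moreover have "p \<noteq> []"
      using p(1) by auto
    then have "(last (map ?g p), hd (map ?g p)) \<in> T"
      using pull[OF p(4)] by (simp add: last_map hd_map)
    ultimately have "has_cycle T"
      unfolding has_cycle_def using p(1) by (intro exI[of _ "map ?g p"]) simp
    with T show False
      by (simp add: spanning_tree_def)
  qed
  moreover have "(f x, f y) \<in> ?T\<^sup>*" if "(x, y) \<in> T\<^sup>*" for x y
    using that by induction (auto intro: rtrancl_into_rtrancl rev_image_eqI)
  moreover have "irrefl ?T"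
    using T TS inj by (auto simp: spanning_tree_def irrefl_def inj_on_def)
  moreover have "sym ?T"
    using T by (fastforce simp: spanning_tree_def sym_def)
  ultimately show ?thesis
    using T TS by (auto simp: spanning_tree_def)
qed

text \<open>For a random \<open>f\<close> this replaces a family of trees that varies with
  \<open>f\<close> by a fixed finite one, which the measurability argument requires.\<close>

lemma spanning_trees_image:
  assumes inj: "inj_on f S"
  shows "{T. spanning_tree (f ` S) T} = (`) (map_prod f f) ` {T. spanning_tree S T}"
proof (intro equalityI subsetI)
  fix T assume "T \<in> {T. spanning_tree (f ` S) T}"
  then have T: "spanning_tree (f ` S) T"
    by simp
  let ?g = "inv_into S f"
  have "spanning_tree (?g ` f ` S) (map_prod ?g ?g ` T)"
    by (rule spanning_tree_image[OF inj_on_inv_into[OF subset_refl] T])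
  moreover have "?g ` f ` S = S"
    using inj by (simp add: image_comp o_def)
  moreover have "map_prod f f ` map_prod ?g ?g ` T = T"
  proof -
    have "map_prod f f (map_prod ?g ?g e) = e" if "e \<in> T" for e
      using that T by (auto simp: spanning_tree_def f_inv_into_f subset_iff map_prod_def split: prod.splits)
    then show ?thesis
      by (force simp: image_comp)
  qed
  ultimately show "T \<in> (`) (map_prod f f) ` {T. spanning_tree S T}"
    by (intro image_eqI[of _ _ "map_prod ?g ?g ` T"]) auto
qed (auto intro: spanning_tree_image[OF inj])

lemma tree_cost_image:
  assumes "inj_on f S" "spanning_tree S T"
  shows "tree_cost d (map_prod f f ` T) = (\<Sum>(x, y)\<in>T. eucl_dist d (f x) (f y)) / 2"
proof -
  have "inj_on (map_prod f f) T"
    using assms by (intro inj_on_subset[OF map_prod_inj_on[OF assms(1) assms(1)]])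
      (simp add: spanning_tree_def)
  then show ?thesis
    by (simp add: tree_cost_def sum.reindex case_prod_unfold)
qed

lemma spanning_tree_singleton: "spanning_tree {r} {}"
  by (auto simp: spanning_tree_def sym_def irrefl_def has_cycle_def)

text \<open>The new vertex \<open>y\<close> has \<open>x\<close> as its only neighbour, so no cycle
  passes through it and any cycle would already lie in \<open>T\<close>.\<close>

lemma spanning_tree_insert:
  assumes T: "spanning_tree Y T" and x: "x \<in> Y" and y: "y \<notin> Y"
  shows "spanning_tree (insert y Y) (insert (x, y) (insert (y, x) T))"
    (is "spanning_tree _ ?T")
proof -
  have TY: "T \<subseteq> Y \<times> Y"
    using T by (simp add: spanning_tree_def)
  have "\<not> has_cycle ?T"
  proof
    assume "has_cycle ?T"
    then obtain p where p: "length p \<ge> 3" "distinct p"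
      "successively (\<lambda>u v. (u, v) \<in> ?T) p" "(last p, hd p) \<in> ?T"
      unfolding has_cycle_def by metis
    have "y \<notin> set p"
    proof
      assume "y \<in> set p"
      then obtain u w where "u \<noteq> w" "(u, y) \<in> ?T" "(y, w) \<in> ?T"
        using cycle_neighbours[OF p] by metis
      then show False
        using TY x y by auto
    qed
    moreover have "p \<noteq> []"
      using p(1) by auto
    ultimately have "y \<noteq> hd p" "y \<noteq> last p"
      by auto
    then have "(last p, hd p) \<in> T"
      using p(4) by auto
    moreover have "successively (\<lambda>u v. (u, v) \<in> T) p"
      using \<open>y \<notin> set p\<close> by (intro successively_mono[OF p(3)]) auto
    ultimately have "has_cycle T"
      unfolding has_cycle_def using p(1,2) by blast
    with T show False
      by (simp add: spanning_tree_def)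
  qed
  moreover have "(u, v) \<in> ?T\<^sup>*" if "u \<in> insert y Y" "v \<in> insert y Y" for u v
  proof -
    have old: "(a, b) \<in> ?T\<^sup>*" if "a \<in> Y" "b \<in> Y" for a b
      using that T rtrancl_mono[of T ?T] by (auto simp: spanning_tree_def)
    have "(x, y) \<in> ?T\<^sup>*" "(y, x) \<in> ?T\<^sup>*"
      by auto
    then have "(u, x) \<in> ?T\<^sup>*" "(x, v) \<in> ?T\<^sup>*"
      using old that x by blast+
    then show ?thesis
      by (rule rtrancl_trans)
  qed
  moreover have "sym ?T"
    using T by (auto simp: spanning_tree_def sym_def)
  moreover have "irrefl ?T"
    using T x y by (auto simp: spanning_tree_def irrefl_def)
  ultimately show ?thesis
    using TY x unfolding spanning_tree_def by blast
qed

section \<open>Upper and lower bounds for the minimum spanning tree cost\<close>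

lemma finite_spanning_trees: "finite Y \<Longrightarrow> finite {T. spanning_tree Y T}"
  by (rule finite_subset[of _ "Pow (Y \<times> Y)"]) (auto simp: spanning_tree_def)

lemma ex_spanning_tree:
  assumes "finite Y" "Y \<noteq> {}"
  shows "\<exists>T. spanning_tree Y T"
  using assms
proof (induction Y rule: finite_ne_induct)
  case (singleton x)
  show ?case
    by (intro exI[of _ "{}"] spanning_tree_singleton)
next
  case (insert y Y)
  then show ?case
    using spanning_tree_insert by (metis ex_in_conv)
qed

lemma mst_cost_le:
  assumes "finite Y" "spanning_tree Y T"
  shows "mst_cost d Y \<le> tree_cost d T"
  unfolding mst_cost_def using assms by (intro Min_le) (auto simp: finite_spanning_trees)

lemma mst_cost_attained:
  assumes "finite Y" "Y \<noteq> {}"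
  obtains T where "spanning_tree Y T" "mst_cost d Y = tree_cost d T"
proof -
  have "mst_cost d Y \<in> tree_cost d ` {T. spanning_tree Y T}"
    unfolding mst_cost_def using assms ex_spanning_tree by (intro Min_in) (auto simp: finite_spanning_trees)
  then show thesis
    using that by auto
qed

lemma mst_cost_le_iff:
  assumes "finite Y" "Y \<noteq> {}"
  shows "mst_cost d Y \<le> c \<longleftrightarrow> (\<exists>T\<in>{T. spanning_tree Y T}. tree_cost d T \<le> c)"
  by (metis mem_Collect_eq assms mst_cost_attained mst_cost_le order_trans)

lemma eucl_dist_commute: "eucl_dist d x y = eucl_dist d y x"
  by (simp add: eucl_dist_def L2_set_def power2_commute)

text \<open>Hang \<open>y\<close> as a leaf at \<open>x\<close> on an optimal tree of
  \<open>Y\<close>.\<close>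

lemma mst_cost_insert_le:
  assumes fin: "finite Y" and x: "x \<in> Y" and y: "y \<notin> Y"
  shows "mst_cost d (insert y Y) \<le> mst_cost d Y + eucl_dist d x y"
proof -
  obtain T where T: "spanning_tree Y T" and cost: "mst_cost d Y = tree_cost d T"
    using mst_cost_attained fin x by (metis empty_iff)
  have TY: "T \<subseteq> Y \<times> Y"
    using T by (simp add: spanning_tree_def)
  then have "finite T"
    using fin finite_subset by blast
  moreover have "(x, y) \<notin> insert (y, x) T" "(y, x) \<notin> T"
    using TY x y by auto
  ultimately have "tree_cost d (insert (x, y) (insert (y, x) T)) = tree_cost d T + eucl_dist d x y"
    by (simp add: tree_cost_def eucl_dist_commute[of d y x])
  then show ?thesis
    using mst_cost_le[OF _ spanning_tree_insert[OF T x y]] fin cost by (metis finite_insert)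
qed

text \<open>Points are attached one at a time. A point outside \<open>A\<close> is joined to the
  root \<open>r\<close> and pays \<open>w\<close>; the first point of a cell is joined to
  \<open>r\<close> and pays at most \<open>K\<close>; a later one is joined to an earlier point of
  its cell and pays at most \<epsilon>. For simplicity \<epsilon> is charged to every point.\<close>

lemma mst_cost_le_cells:
  assumes "finite Y" "r \<notin> Y" "0 \<le> \<epsilon>"
    and centre: "\<And>y. y \<in> Y \<inter> A \<Longrightarrow> eucl_dist d r y \<le> K"
    and far: "\<And>y. y \<in> Y - A \<Longrightarrow> eucl_dist d r y \<le> w y"
    and cell: "\<And>y y'. y \<in> Y \<inter> A \<Longrightarrow> y' \<in> Y \<inter> A \<Longrightarrow> c y = c y' \<Longrightarrow> eucl_dist d y y' \<le> \<epsilon>"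
  shows "mst_cost d (insert r Y)
           \<le> \<epsilon> * real (card Y) + K * real (card (c ` (Y \<inter> A))) + (\<Sum>y\<in>Y - A. w y)"
  using \<open>finite Y\<close> \<open>r \<notin> Y\<close> centre far cell
proof (induction Y rule: finite_induct)
  case empty
  show ?case
    using mst_cost_le[OF _ spanning_tree_singleton[of r]] by (simp add: tree_cost_def)
next
  case (insert y Y)
  let ?F = "\<lambda>Y. \<epsilon> * real (card Y) + K * real (card (c ` (Y \<inter> A))) + (\<Sum>y\<in>Y - A. w y)"
  have IH: "mst_cost d (insert r Y) \<le> ?F Y"
    by (rule insert.IH) (use insert.prems in auto)
  have step: "mst_cost d (insert r (insert y Y)) \<le> mst_cost d (insert r Y) + eucl_dist d x y"
    if "x \<in> insert r Y" for x
    unfolding insert_commute[of r y] using insert that by (intro mst_cost_insert_le) auto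
  consider (far) "y \<notin> A" | (new) "y \<in> A" "c y \<notin> c ` (Y \<inter> A)" | (old) "y \<in> A" "c y \<in> c ` (Y \<inter> A)"
    by blast
  then show ?case
  proof cases
    case far
    then have "?F (insert y Y) = ?F Y + \<epsilon> + w y"
      using insert.hyps by (simp add: insert_Diff_if algebra_simps)
    then show ?thesis
      using step[of r] insert.prems(3)[of y] far IH \<open>0 \<le> \<epsilon>\<close> by simp
  next
    case new
    then have "?F (insert y Y) = ?F Y + \<epsilon> + K"
      using insert.hyps by (simp add: insert_Diff_if algebra_simps)
    then show ?thesis
      using step[of r] insert.prems(2)[of y] new IH \<open>0 \<le> \<epsilon>\<close> by simp
  next
    case old
    then obtain x where x: "x \<in> Y \<inter> A" "c y = c x"
      by blast
    have "?F (insert y Y) = ?F Y + \<epsilon>"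
      using insert.hyps old by (simp add: insert_Diff_if insert_absorb algebra_simps)
    moreover have "eucl_dist d x y \<le> \<epsilon>"
      using insert.prems(4)[of x y] x old by simp
    ultimately show ?thesis
      using step[of x] x IH by simp
  qed
qed

text \<open>With at least two vertices, connectedness gives each vertex an outgoing pair in
  \<open>T\<close>. Thus \<open>T\<close> has at least \<open>card Y\<close> ordered pairs, and the
  halving in \<open>tree_cost\<close> gives the factor 1/2.\<close>

lemma card_le_mst_cost:
  assumes fin: "finite Y" and card: "card Y \<ge> 2"
    and sep: "\<And>x y. x \<in> Y \<Longrightarrow> y \<in> Y \<Longrightarrow> x \<noteq> y \<Longrightarrow> eucl_dist m x y \<ge> s" and "0 \<le> s"
  shows "s * real (card Y) / 2 \<le> mst_cost m Y"
proof -
  have "Y \<noteq> {}"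
    using card by auto
  then obtain T where T: "spanning_tree Y T" and cost: "mst_cost m Y = tree_cost m T"
    using mst_cost_attained fin by metis
  have TY: "T \<subseteq> Y \<times> Y"
    using T by (simp add: spanning_tree_def)
  then have "finite T"
    using fin finite_subset by blast
  have "Y \<subseteq> fst ` T"
  proof
    fix x assume x: "x \<in> Y"
    have "Y \<noteq> {x}"
      using card by auto
    then obtain y where "y \<in> Y" "y \<noteq> x"
      using x by blast
    then have "(x, y) \<in> T\<^sup>*"
      using T x by (simp add: spanning_tree_def)
    then show "x \<in> fst ` T"
      using \<open>y \<noteq> x\<close> by (metis converse_rtranclE fst_conv image_eqI)
  qed
  then have "card Y \<le> card T"
    using surj_card_le[OF \<open>finite T\<close>] by blast
  then have "s * real (card Y) \<le> s * real (card T)"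
    using \<open>0 \<le> s\<close> by (simp add: mult_left_mono)
  also have "\<dots> \<le> (\<Sum>(x, y)\<in>T. eucl_dist m x y)"
  proof -
    have "s \<le> eucl_dist m x y" if "(x, y) \<in> T" for x y
      using that TY T by (intro sep) (auto simp: spanning_tree_def irrefl_def)
    then show ?thesis
      using sum_bounded_below[of T s "\<lambda>(x, y). eucl_dist m x y"] by (auto simp: mult.commute)
  qed
  finally show ?thesis
    by (simp add: cost tree_cost_def)
qed

section \<open>Counting the grid cells that meet a ball\<close>

text \<open>The exact value is stated because the bound 3 alone would not carry the
  induction.\<close>

lemma sum_int_weights:
  "(\<Sum>k\<in>{-int M..int M}. 2 powr - \<bar>real_of_int k\<bar>) = 3 - 2 * 2 powr - real M"
proof (induction M)
  case (Suc M)
  have "{-int (Suc M)..int (Suc M)} = insert (-int (Suc M)) (insert (int (Suc M)) {-int M..int M})"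
    by auto
  moreover have "2 powr (- 1 - real M) = 2 powr - real M / 2"
    by (simp add: powr_diff powr_minus field_simps)
  ultimately show ?case
    using Suc by (simp add: algebra_simps)
qed simp

text \<open>A Chernoff-type count: each coordinate \<open>k\<close> is given the weight \<open>2 powr - \<bar>k\<bar>\<close>, and these
  weights add up to at most 3.\<close>

lemma card_int_l1_ball_le:
  assumes sub: "Z \<subseteq> {..<d} \<rightarrow>\<^sub>E (UNIV :: int set)" and "finite Z"
    and K: "\<And>z. z \<in> Z \<Longrightarrow> (\<Sum>i<d. \<bar>real_of_int (z i)\<bar>) \<le> K"
  shows "real (card Z) \<le> 3 ^ d * 2 powr K"
proof -
  \<comment> \<open>The box of half-width \<open>M\<close> only makes the sums finite; the resulting
    bound \<open>3 ^ d\<close> is independent of \<open>M\<close>.\<close>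
  define M where "M = nat \<lceil>K\<rceil>"
  let ?w = "\<lambda>k. 2 powr - \<bar>real_of_int k\<bar>"
  have "Z \<subseteq> {..<d} \<rightarrow>\<^sub>E {-int M..int M}"
  proof (intro subsetI PiE_I)
    fix z i assume z: "z \<in> Z" and i: "i \<in> {..<d}"
    have "\<bar>real_of_int (z i)\<bar> \<le> (\<Sum>i<d. \<bar>real_of_int (z i)\<bar>)"
      using i by (intro member_le_sum) auto
    then have "\<bar>real_of_int (z i)\<bar> \<le> K"
      using K[OF z] by simp
    then have "\<bar>z i\<bar> \<le> int M"
      unfolding M_def by linarith
    then show "z i \<in> {-int M..int M}"
      by auto
  qed (use sub in auto)
  then have "(\<Sum>z\<in>Z. \<Prod>i<d. ?w (z i)) \<le> (\<Sum>z\<in>{..<d} \<rightarrow>\<^sub>E {-int M..int M}. \<Prod>i<d. ?w (z i))"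
    by (intro sum_mono2) (auto intro: finite_PiE prod_nonneg)
  also have "\<dots> = (\<Prod>i<d. \<Sum>k\<in>{-int M..int M}. ?w k)"
    by (rule prod_sum_PiE[symmetric]) auto
  also have "\<dots> \<le> (\<Prod>i<d. 3)"
    unfolding sum_int_weights using powr_mono[of "- real M" 0 2] by (intro prod_mono) auto
  finally have upper: "(\<Sum>z\<in>Z. \<Prod>i<d. ?w (z i)) \<le> 3 ^ d"
    by simp
  have "2 powr - K \<le> (\<Prod>i<d. ?w (z i))" if "z \<in> Z" for z
  proof -
    have "(\<Prod>i<d. ?w (z i)) = 2 powr - (\<Sum>i<d. \<bar>real_of_int (z i)\<bar>)"
      by (simp add: powr_sum flip: sum_negf)
    then show ?thesis
      using K[OF that] by simp
  qed
  then have "real (card Z) * 2 powr - K \<le> 3 ^ d"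
    using sum_bounded_below[of Z "2 powr - K" "\<lambda>z. \<Prod>i<d. ?w (z i)"] upper by force
  then show ?thesis
    by (simp add: powr_minus field_simps)
qed

text \<open>The mesh is \<epsilon> divided by \<open>sqrt d\<close>, so that a cube of the grid has
  Euclidean diameter \<epsilon>.\<close>

definition grid_cell :: "nat \<Rightarrow> real \<Rightarrow> (nat \<Rightarrow> real) \<Rightarrow> nat \<Rightarrow> int" where
  "grid_cell d \<epsilon> y = (\<lambda>i\<in>{..<d}. \<lfloor>y i * sqrt (real d) / \<epsilon>\<rfloor>)"

lemma eucl_dist_le_add: "eucl_dist d x y \<le> L2_set x {..<d} + L2_set y {..<d}"
  using L2_set_triangle_ineq[of x "\<lambda>i. - y i" "{..<d}"]
  by (simp add: eucl_dist_def L2_set_def)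

lemma eucl_dist_grid_cell_le:
  assumes "d \<ge> 1" "\<epsilon> > 0" and eq: "grid_cell d \<epsilon> x = grid_cell d \<epsilon> y"
  shows "eucl_dist d x y \<le> \<epsilon>"
proof -
  have "\<bar>x i - y i\<bar> \<le> \<epsilon> / sqrt (real d)" if "i < d" for i
  proof -
    have "\<lfloor>x i * sqrt (real d) / \<epsilon>\<rfloor> = \<lfloor>y i * sqrt (real d) / \<epsilon>\<rfloor>"
      using fun_cong[OF eq, of i] that by (simp add: grid_cell_def)
    then have "\<bar>x i * sqrt (real d) / \<epsilon> - y i * sqrt (real d) / \<epsilon>\<bar> \<le> 1"
      by linarith
    moreover have "x i * sqrt (real d) / \<epsilon> - y i * sqrt (real d) / \<epsilon> = (x i - y i) * (sqrt (real d) / \<epsilon>)"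
      by (simp add: algebra_simps diff_divide_distrib)
    ultimately have "\<bar>x i - y i\<bar> * (sqrt (real d) / \<epsilon>) \<le> 1"
      using assms by (simp add: abs_mult)
    then show ?thesis
      using assms by (simp add: field_simps)
  qed
  then have "eucl_dist d x y \<le> L2_set (\<lambda>_. \<epsilon> / sqrt (real d)) {..<d}"
    unfolding eucl_dist_def L2_set_def
    by (intro real_sqrt_le_mono sum_mono) (simp add: abs_le_square_iff[symmetric] assms(2) less_imp_le)
  also have "\<dots> = \<epsilon>"
    using assms by (simp add: L2_set_constant)
  finally show ?thesis .
qed

text \<open>By Cauchy-Schwarz the l1 norm is at most \<open>sqrt d\<close> times the Euclidean norm;
  together with the \<open>sqrt d\<close> in the mesh this yields
  \<open>d * (R / \<epsilon>)\<close>. Rounding adds at most 1 per coordinate. Hence the count is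
  exponential in \<open>d\<close> with a base depending only on
  \<open>R / \<epsilon>\<close>.\<close>

lemma card_grid_cells_le:
  assumes "finite Y" "d \<ge> 1" "\<epsilon> > 0" and R: "\<And>y. y \<in> Y \<Longrightarrow> L2_set y {..<d} \<le> R"
  shows "real (card (grid_cell d \<epsilon> ` Y)) \<le> 3 ^ d * 2 powr (real d * (R / \<epsilon> + 1))"
proof (rule card_int_l1_ball_le)
  fix z assume "z \<in> grid_cell d \<epsilon> ` Y"
  then obtain y where y: "y \<in> Y" "z = grid_cell d \<epsilon> y"
    by auto
  have "(\<Sum>i<d. \<bar>real_of_int (z i)\<bar>) \<le> (\<Sum>i<d. sqrt (real d) / \<epsilon> * \<bar>y i\<bar> + 1)"
  proof (rule sum_mono)
    fix i assume "i \<in> {..<d}"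
    then have "z i = \<lfloor>y i * sqrt (real d) / \<epsilon>\<rfloor>"
      by (simp add: y(2) grid_cell_def)
    then have "\<bar>real_of_int (z i)\<bar> \<le> \<bar>y i * sqrt (real d) / \<epsilon>\<bar> + 1"
      by linarith
    then show "\<bar>real_of_int (z i)\<bar> \<le> sqrt (real d) / \<epsilon> * \<bar>y i\<bar> + 1"
      using \<open>\<epsilon> > 0\<close> by (simp add: abs_mult mult.commute)
  qed
  \<comment> \<open>The factor \<open>\<bar>1\<bar>\<close> brings the sum into the form of
    Cauchy-Schwarz in \<open>L2_set_mult_ineq\<close>.\<close>
  also have "\<dots> = sqrt (real d) / \<epsilon> * (\<Sum>i<d. \<bar>1\<bar> * \<bar>y i\<bar>) + real d"
    by (simp add: sum.distrib sum_distrib_left)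
  also have "\<dots> \<le> sqrt (real d) / \<epsilon> * (sqrt (real d) * R) + real d"
  proof -
    have "(\<Sum>i<d. \<bar>1\<bar> * \<bar>y i\<bar>) \<le> sqrt (real d) * L2_set y {..<d}"
      using L2_set_mult_ineq[of "\<lambda>_. 1" y "{..<d}"] by (simp add: L2_set_constant)
    also have "\<dots> \<le> sqrt (real d) * R"
      using R[OF y(1)] by (simp add: mult_left_mono)
    finally show ?thesis
      using \<open>\<epsilon> > 0\<close> by (intro add_right_mono mult_left_mono) auto
  qed
  also have "\<dots> = real d * (R / \<epsilon> + 1)"
    by (simp add: field_simps)
  finally show "(\<Sum>i<d. \<bar>real_of_int (z i)\<bar>) \<le> real d * (R / \<epsilon> + 1)" .
next
  show "grid_cell d \<epsilon> ` Y \<subseteq> {..<d} \<rightarrow>\<^sub>E UNIV"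
    by (rule image_subsetI) (simp add: grid_cell_def)
qed (use assms in simp)

section \<open>Tree cost in terms of the sum of squared norms\<close>

text \<open>The origin need not belong to \<open>Y\<close>, so a point \<open>r\<close> of least
  norm serves as the root: its distance to \<open>y\<close> is at most twice the norm of
  \<open>y\<close>. This is at most \<open>2 * R\<close> in the ball of radius \<open>R\<close>, and
  outside it at most \<open>2 / R\<close> times the squared norm.\<close>

lemma mst_cost_le_second_moment:
  assumes "finite Y" "Y \<noteq> {}" "d \<ge> 1" "\<epsilon> > 0" "R > 0"
  shows "mst_cost d Y \<le> \<epsilon> * real (card Y) + 2 * R * (3 ^ d * 2 powr (real d * (R / \<epsilon> + 1)))
           + 2 / R * (\<Sum>y\<in>Y. (L2_set y {..<d})\<^sup>2)"
proof -
  let ?N = "\<lambda>y. L2_set y {..<d}"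
  let ?c = "grid_cell d \<epsilon>"
  define A where "A = {y. ?N y \<le> R}"
  define r where "r = arg_min_on ?N Y"
  have "r \<in> Y"
    unfolding r_def by (rule arg_min_if_finite(1)[where f = ?N, OF assms(1,2)])
  have r_min: "?N r \<le> ?N y" if "y \<in> Y" for y
    unfolding r_def by (rule arg_min_least[where f = ?N, OF assms(1,2) that])
  define Y' where "Y' = Y - {r}"
  have Y': "finite Y'" "r \<notin> Y'" "insert r Y' = Y" "Y' \<subseteq> Y"
    using assms \<open>r \<in> Y\<close> by (auto simp: Y'_def)
  have dist: "eucl_dist d r y \<le> 2 * ?N y" if "y \<in> Y'" for y
  proof -
    have "?N r \<le> ?N y"
      using that Y'(4) by (intro r_min) auto
    then show ?thesis
      using eucl_dist_le_add[of d r y] by linarith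
  qed
  have far: "2 * ?N y \<le> 2 / R * (?N y)\<^sup>2" if "?N y > R" for y
    using that \<open>R > 0\<close> by (simp add: field_simps power2_eq_square)
  have "mst_cost d (insert r Y')
      \<le> \<epsilon> * real (card Y') + 2 * R * real (card (?c ` (Y' \<inter> A))) + (\<Sum>y\<in>Y' - A. 2 / R * (?N y)\<^sup>2)"
  proof (rule mst_cost_le_cells)
    fix y assume "y \<in> Y' \<inter> A"
    then show "eucl_dist d r y \<le> 2 * R"
      using dist[of y] by (simp add: A_def)
  next
    fix y assume "y \<in> Y' - A"
    then show "eucl_dist d r y \<le> 2 / R * (?N y)\<^sup>2"
      using dist[of y] far[of y] by (simp add: A_def)
  next
    show "eucl_dist d y y' \<le> \<epsilon>" if "?c y = ?c y'" for y y'
      using that assms(3,4) by (rule eucl_dist_grid_cell_le[rotated 2])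
  qed (use Y'(1,2) assms(4) in auto)
  also have "\<dots> \<le> \<epsilon> * real (card Y) + 2 * R * (3 ^ d * 2 powr (real d * (R / \<epsilon> + 1)))
      + (\<Sum>y\<in>Y. 2 / R * (?N y)\<^sup>2)"
  proof (intro add_mono mult_left_mono)
    show "real (card Y') \<le> real (card Y)"
      using Y'(4) assms(1) by (simp add: card_mono)
    show "real (card (?c ` (Y' \<inter> A))) \<le> 3 ^ d * 2 powr (real d * (R / \<epsilon> + 1))"
      using assms(3,4) Y'(1) by (intro card_grid_cells_le) (auto simp: A_def)
    show "(\<Sum>y\<in>Y' - A. 2 / R * (?N y)\<^sup>2) \<le> (\<Sum>y\<in>Y. 2 / R * (?N y)\<^sup>2)"
      using assms(1,5) Y'(4) by (intro sum_mono2) auto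
  qed (use assms(4,5) in auto)
  finally show ?thesis
    by (simp add: Y'(3) sum_distrib_left)
qed

section \<open>The standard basis and its doubling constant\<close>

definition std_basis_vec :: "nat \<Rightarrow> nat \<Rightarrow> nat \<Rightarrow> real" where
  "std_basis_vec n i = (\<lambda>j\<in>{..<n}. if j = i then 1 else 0)"

lemma eucl_dist_std_basis_vec:
  assumes "i < n" "j < n" "i \<noteq> j"
  shows "eucl_dist n (std_basis_vec n i) (std_basis_vec n j) = sqrt 2"
proof -
  have "(\<Sum>k<n. (std_basis_vec n i k - std_basis_vec n j k)\<^sup>2)
      = (\<Sum>k<n. (if k = i then 1 else 0) + (if k = j then 1 else 0))"
    using assms by (intro sum.cong) (auto simp: std_basis_vec_def)
  also have "\<dots> = 2"
    using assms by (simp add: sum.distrib)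
  finally show ?thesis
    by (simp add: eucl_dist_def L2_set_def)
qed

lemma eucl_dist_self [simp]: "eucl_dist m x x = 0"
  by (simp add: eucl_dist_def L2_set_def)

lemma inj_on_std_basis_vec: "inj_on (std_basis_vec n) {..<n}"
proof (rule inj_onI)
  fix i j assume "i \<in> {..<n}" "j \<in> {..<n}" "std_basis_vec n i = std_basis_vec n j"
  then show "i = j"
    using eucl_dist_std_basis_vec[of i n j] by (cases "i = j") auto
qed

lemma mat_apply_std_basis_vec:
  assumes "i < n"
  shows "mat_apply d n G (std_basis_vec n i) = (\<lambda>k\<in>{..<d}. G (k, i))"
proof -
  have "(\<Sum>j<n. G (k, j) * std_basis_vec n i j) = G (k, i)" for k
  proof -
    have "(\<Sum>j<n. G (k, j) * std_basis_vec n i j) = (\<Sum>j<n. if j = i then G (k, j) else 0)"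
      by (intro sum.cong) (auto simp: std_basis_vec_def)
    then show ?thesis
      using assms by simp
  qed
  then show ?thesis
    by (simp add: mat_apply_def)
qed

text \<open>A ball of radius \<open>s\<close> is all of \<open>X\<close>, while balls of radius
  \<open>s / 2\<close> are single points, so a cover needs every point as a centre. Conversely
  \<open>X\<close> covers itself at every scale.\<close>

lemma doubling_constant_equidistant:
  assumes fin: "finite X" and x: "x \<in> X" and "s > 0"
    and s: "\<And>x y. x \<in> X \<Longrightarrow> y \<in> X \<Longrightarrow> x \<noteq> y \<Longrightarrow> eucl_dist m x y = s"
  shows "doubling_constant m X = card X"
  unfolding doubling_constant_def
proof (rule Least_equality)
  show "\<forall>x\<in>X. \<forall>r>0. \<exists>S\<subseteq>X. finite S \<and> card S \<le> card X \<and>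
      ball_in m X x r \<subseteq> (\<Union>s\<in>S. ball_in m X s (r / 2))"
    using fin by (intro ballI allI impI exI[of _ X]) (auto simp: ball_in_def)
next
  fix k assume "\<forall>x\<in>X. \<forall>r>0. \<exists>S\<subseteq>X. finite S \<and> card S \<le> k \<and>
      ball_in m X x r \<subseteq> (\<Union>s\<in>S. ball_in m X s (r / 2))"
  then obtain S where S: "S \<subseteq> X" "finite S" "card S \<le> k"
    "ball_in m X x s \<subseteq> (\<Union>t\<in>S. ball_in m X t (s / 2))"
    using x \<open>s > 0\<close> by meson
  have "X \<subseteq> S"
  proof
    fix y assume y: "y \<in> X"
    then have "eucl_dist m x y \<le> s"
      using s[OF x y] \<open>s > 0\<close> by (cases "x = y") auto
    then have "y \<in> ball_in m X x s"
      using y by (simp add: ball_in_def)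
    then obtain t where t: "t \<in> S" "eucl_dist m t y \<le> s / 2"
      using S(4) by (auto simp: ball_in_def)
    then have "t = y"
      using s[of t y] S(1) y \<open>s > 0\<close> by (cases "t = y") auto
    then show "y \<in> S"
      using t by simp
  qed
  then show "card X \<le> k"
    using S(2,3) card_mono le_trans by blast
qed

section \<open>Measurability of the cost of a random image\<close>

text \<open>\<open>measure\<close> is 0 on sets that are not measurable, so a lower bound on the
  probability of this event depends on its measurability.\<close>

lemma sets_mst_cost_image_le:
  assumes fin: "finite X" and ne: "X \<noteq> {}"
    and ext: "\<And>\<omega> x. x \<in> X \<Longrightarrow> f \<omega> x \<in> extensional {..<d}"
    and meas: "\<And>x k. x \<in> X \<Longrightarrow> k < d \<Longrightarrow> (\<lambda>\<omega>. f \<omega> x k) \<in> borel_measurable M"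
  shows "{\<omega> \<in> space M. mst_cost d (f \<omega> ` X) \<le> c} \<in> sets M"
proof -
  \<comment> \<open>\<open>f \<omega>\<close> may collapse points, so the set of trees depends on \<open>\<omega>\<close>; a set \<open>S\<close> of representatives
    of its fibres reduces it to finitely many cases.\<close>
  define Q where "Q \<omega> S \<longleftrightarrow> (\<forall>x\<in>S. \<forall>y\<in>S - {x}. \<not> (\<forall>k\<in>{..<d}. f \<omega> x k = f \<omega> y k))
    \<and> (\<forall>x\<in>X. \<exists>y\<in>S. \<forall>k\<in>{..<d}. f \<omega> x k = f \<omega> y k)
    \<and> (\<exists>T\<in>{T. spanning_tree S T}. (\<Sum>e\<in>T. eucl_dist d (f \<omega> (fst e)) (f \<omega> (snd e))) / 2 \<le> c)" for \<omega> S
  let ?P = "{S. S \<subseteq> X \<and> S \<noteq> {}}"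
  \<comment> \<open>Extensionality turns equality of image points into finitely many equations
    between coordinates, so \<open>Q\<close> is a finite Boolean combination of conditions on
    measurable real functions.\<close>
  have eq: "f \<omega> x = f \<omega> y \<longleftrightarrow> (\<forall>k\<in>{..<d}. f \<omega> x k = f \<omega> y k)" if "x \<in> X" "y \<in> X" for \<omega> x y
    using extensionalityI[OF ext[OF that(1)] ext[OF that(2)]] by metis
  have Q_iff: "Q \<omega> S \<longleftrightarrow> inj_on (f \<omega>) S \<and> f \<omega> ` X = f \<omega> ` S \<and> mst_cost d (f \<omega> ` S) \<le> c"
    if "S \<in> ?P" for \<omega> S
  proof -
    have S: "S \<subseteq> X" "S \<noteq> {}" "finite S"
      using that fin finite_subset by auto
    have 1: "(\<forall>x\<in>S. \<forall>y\<in>S - {x}. \<not> (\<forall>k\<in>{..<d}. f \<omega> x k = f \<omega> y k)) \<longleftrightarrow> inj_on (f \<omega>) S"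
      using eq S(1) unfolding inj_on_def by blast
    have "(\<forall>x\<in>X. \<exists>y\<in>S. \<forall>k\<in>{..<d}. f \<omega> x k = f \<omega> y k) \<longleftrightarrow> (\<forall>x\<in>X. \<exists>y\<in>S. f \<omega> x = f \<omega> y)"
      using eq S(1) by (meson subsetD)
    also have "\<dots> \<longleftrightarrow> f \<omega> ` X = f \<omega> ` S"
      using S(1) by blast
    finally have 2: "(\<forall>x\<in>X. \<exists>y\<in>S. \<forall>k\<in>{..<d}. f \<omega> x k = f \<omega> y k) \<longleftrightarrow> f \<omega> ` X = f \<omega> ` S" .
    \<comment> \<open>Injectivity on \<open>S\<close> allows the trees to be taken on the fixed set
      \<open>S\<close> and only the edge lengths to vary with \<omega>.\<close>
    have 3: "mst_cost d (f \<omega> ` S) \<le> c \<longleftrightarrow>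
        (\<exists>T\<in>{T. spanning_tree S T}. (\<Sum>e\<in>T. eucl_dist d (f \<omega> (fst e)) (f \<omega> (snd e))) / 2 \<le> c)"
      if inj: "inj_on (f \<omega>) S"
      using S by (simp add: mst_cost_le_iff spanning_trees_image[OF inj] case_prod_unfold
        tree_cost_image[OF inj] cong: conj_cong)
    show ?thesis
      unfolding Q_def using 1 2 3 by blast
  qed
  have "mst_cost d (f \<omega> ` X) \<le> c \<longleftrightarrow> (\<exists>S\<in>?P. Q \<omega> S)" for \<omega>
  proof
    assume le: "mst_cost d (f \<omega> ` X) \<le> c"
    obtain S where S: "S \<subseteq> X" "inj_on (f \<omega>) S" "f \<omega> ` X = f \<omega> ` S"
      using subset_image_inj[of "f \<omega> ` X" "f \<omega>" X] by auto
    then have "S \<in> ?P"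
      using ne by auto
    then show "\<exists>S\<in>?P. Q \<omega> S"
      using S le Q_iff by (intro bexI[of _ S]) auto
  next
    assume "\<exists>S\<in>?P. Q \<omega> S"
    then show "mst_cost d (f \<omega> ` X) \<le> c"
      using Q_iff by metis
  qed
  then have "{\<omega> \<in> space M. mst_cost d (f \<omega> ` X) \<le> c} = {\<omega> \<in> space M. \<exists>S\<in>?P. Q \<omega> S}"
    by simp
  also have "\<dots> \<in> sets M"
  proof (intro sets.sets_Collect_finite_Ex)
    fix S assume "S \<in> ?P"
    then have S: "S \<subseteq> X" "finite S"
      using fin finite_subset by auto
    have coord: "(\<lambda>\<omega>. f \<omega> x k) \<in> borel_measurable M" if "x \<in> S" "k < d" for x k
      using meas that S(1) by blast
    have cost: "(\<lambda>\<omega>. \<Sum>e\<in>T. eucl_dist d (f \<omega> (fst e)) (f \<omega> (snd e))) \<in> borel_measurable M"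
      if "T \<in> {T. spanning_tree S T}" for T
    proof (rule borel_measurable_sum)
      fix e assume "e \<in> T"
      then have "fst e \<in> S" "snd e \<in> S"
        using that by (auto simp: spanning_tree_def)
      then show "(\<lambda>\<omega>. eucl_dist d (f \<omega> (fst e)) (f \<omega> (snd e))) \<in> borel_measurable M"
        unfolding eucl_dist_def L2_set_def
        by (intro measurable_compose[OF _ borel_measurable_sqrt] borel_measurable_sum
            borel_measurable_power borel_measurable_diff coord) auto
    qed
    have same: "{\<omega> \<in> space M. \<forall>k\<in>{..<d}. f \<omega> x k = f \<omega> y k} \<in> sets M" if "x \<in> X" "y \<in> X" for x y
      using meas that
      by (intro sets.sets_Collect_finite_All borel_measurable_eq) auto
    show "{\<omega> \<in> space M. Q \<omega> S} \<in> sets M"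
      unfolding Q_def
    proof (intro sets.sets_Collect_conj)
      show "{\<omega> \<in> space M. \<forall>x\<in>S. \<forall>y\<in>S - {x}. \<not> (\<forall>k\<in>{..<d}. f \<omega> x k = f \<omega> y k)} \<in> sets M"
        using S by (intro sets.sets_Collect_finite_All sets.sets_Collect_neg same) auto
      show "{\<omega> \<in> space M. \<forall>x\<in>X. \<exists>y\<in>S. \<forall>k\<in>{..<d}. f \<omega> x k = f \<omega> y k} \<in> sets M"
        using S fin by (intro sets.sets_Collect_finite_All sets.sets_Collect_finite_Ex same) auto
      show "{\<omega> \<in> space M. \<exists>T\<in>{T. spanning_tree S T}.
          (\<Sum>e\<in>T. eucl_dist d (f \<omega> (fst e)) (f \<omega> (snd e))) / 2 \<le> c} \<in> sets M"
        using S by (intro sets.sets_Collect_finite_Ex borel_measurable_le borel_measurable_divide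
            cost finite_spanning_trees) auto
    qed
  qed (use fin in auto)
  finally show ?thesis .
qed

section \<open>Second moments of the Gaussian matrix and the cost of its columns\<close>

lemma measurable_random_projection_component [measurable]:
  assumes "i < d" "j < m"
  shows "(\<lambda>G. G (i, j)) \<in> borel_measurable (random_projection d m)"
proof -
  have "(\<lambda>G. G (i, j)) \<in> random_projection d m \<rightarrow>\<^sub>M
      density lborel (\<lambda>x. ennreal (normal_density 0 (sqrt (1 / real d)) x))"
    unfolding random_projection_def using assms by (intro measurable_component_singleton) auto
  then show ?thesis
    by simp
qed

lemma prob_space_random_projection:
  assumes "d \<ge> 1"
  shows "prob_space (random_projection d m)"
  unfolding random_projection_def using assms
  by (intro prob_space_PiM prob_space_normal_density) auto

lemma has_bochner_integral_random_projection_square: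
  assumes "i < d" "j < m"
  shows "has_bochner_integral (random_projection d m) (\<lambda>G. (G (i, j))\<^sup>2) (1 / real d)"
proof -
  define N where "N = density lborel (\<lambda>x. ennreal (normal_density 0 (sqrt (1 / real d)) x))"
  have "d > 0"
    using assms by simp
  then have "prob_space N"
    unfolding N_def by (intro prob_space_normal_density) auto
  then have distr: "distr (random_projection d m) N (\<lambda>G. G (i, j)) = N"
    unfolding random_projection_def N_def[symmetric] using assms by (intro distr_PiM_component) auto
  \<comment> \<open>In the instance of \<open>normal_moment_even\<close>, 0 is the mean and 1 is
    half the order of the moment; the second central moment is the variance.\<close>
  have "has_bochner_integral N (\<lambda>x. x\<^sup>2) (1 / real d)"
    unfolding N_def using normal_moment_even[of "sqrt (1 / real d)" 0 1] \<open>d > 0\<close>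
    by (intro has_bochner_integral_density) (auto simp: power2_eq_square mult_ac)
  then have "has_bochner_integral (distr (random_projection d m) N (\<lambda>G. G (i, j))) (\<lambda>x. x\<^sup>2) (1 / real d)"
    by (simp add: distr)
  then show ?thesis
    using measurable_random_projection_component[OF assms]
    by (simp add: has_bochner_integral_iff integrable_distr_eq integral_distr N_def)
qed

text \<open>The \<open>n * d\<close> entries have second moment \<open>1 / d\<close> each, so the
  sum has expectation \<open>n\<close>; Markov's inequality at three times this value gives
  1/3.\<close>

lemma prob_random_projection_square_sum_ge:
  assumes "d \<ge> 1" "n \<ge> 1"
  shows "measure (random_projection d n)
    {G \<in> space (random_projection d n). (\<Sum>i<n. \<Sum>k<d. (G (k, i))\<^sup>2) \<ge> 3 * real n} \<le> 1 / 3"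
proof -
  let ?M = "random_projection d n"
  let ?S = "\<lambda>G. \<Sum>i<n. \<Sum>k<d. (G (k, i))\<^sup>2"
  have "has_bochner_integral ?M ?S (\<Sum>i<n. \<Sum>k<d. 1 / real d)"
    by (intro has_bochner_integral_sum has_bochner_integral_random_projection_square) auto
  then have "integrable ?M ?S" "integral\<^sup>L ?M ?S = real n"
    using assms by (auto simp: has_bochner_integral_iff)
  then show ?thesis
    using integral_Markov_inequality_measure[of ?M ?S "{}" "3 * real n"] assms
    by (auto simp: sum_nonneg)
qed

text \<open>The cell diameter is \<open>1 / R\<close>. The constant 7 is 1 + 2 * 3: edges within
  cells cost \<open>1 / R\<close> per point, and the far points cost \<open>2 / R\<close> times a
  sum of squares of at most \<open>3 * n\<close>. Columns may coincide, which only decreases the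
  number of points and the sum.\<close>

lemma mst_cost_columns_le:
  assumes "d \<ge> 1" "n \<ge> 1" "R > 0" and S: "(\<Sum>i<n. \<Sum>k<d. (G (k, i))\<^sup>2) \<le> 3 * real n"
  shows "mst_cost d (mat_apply d n G ` std_basis_vec n ` {..<n})
    \<le> 7 / R * real n + 2 * R * (3 ^ d * 2 powr (real d * (R\<^sup>2 + 1)))"
proof -
  define col where "col = (\<lambda>i. \<lambda>k\<in>{..<d}. G (k, i))"
  let ?Y = "col ` {..<n}"
  have Y: "mat_apply d n G ` std_basis_vec n ` {..<n} = ?Y"
    by (auto simp: image_image mat_apply_std_basis_vec col_def)
  have "(\<Sum>y\<in>?Y. (L2_set y {..<d})\<^sup>2) \<le> (\<Sum>i<n. (L2_set (col i) {..<d})\<^sup>2)"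
    using sum_image_le[of "{..<n}" "\<lambda>y. (L2_set y {..<d})\<^sup>2" col] by simp
  also have "\<dots> = (\<Sum>i<n. \<Sum>k<d. (G (k, i))\<^sup>2)"
    by (simp add: L2_set_def sum_nonneg col_def)
  finally have sq: "(\<Sum>y\<in>?Y. (L2_set y {..<d})\<^sup>2) \<le> 3 * real n"
    using S by simp
  have card: "real (card ?Y) \<le> real n"
    using card_image_le[of "{..<n}" col] by simp
  have "mst_cost d ?Y \<le> 1 / R * real (card ?Y) + 2 * R * (3 ^ d * 2 powr (real d * (R / (1 / R) + 1)))
      + 2 / R * (\<Sum>y\<in>?Y. (L2_set y {..<d})\<^sup>2)"
    using assms by (intro mst_cost_le_second_moment) (auto simp: lessThan_empty_iff)
  also have "\<dots> \<le> 1 / R * real n + 2 * R * (3 ^ d * 2 powr (real d * (R / (1 / R) + 1))) + 2 / R * (3 * real n)"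
    using sq card \<open>R > 0\<close> by (intro add_mono mult_left_mono) auto
  also have "\<dots> = 7 / R * real n + 2 * R * (3 ^ d * 2 powr (real d * (R\<^sup>2 + 1)))"
    by (simp add: power2_eq_square field_simps)
  finally show ?thesis
    by (simp add: Y)
qed

section \<open>Asymptotics for a slowly growing radius\<close>

text \<open>With \<open>R ^ 4 = ln n / d\<close> the radius tends to infinity, yet
  \<open>d * R\<^sup>2\<close> is \<open>ln n / R\<^sup>2\<close>, of smaller order than
  \<open>ln n\<close>. The number of cells is therefore a vanishing power of \<open>n\<close>; the
  proof settles for the square root of \<open>n\<close>.\<close>

lemma stretch_bound_tendsto_0:
  fixes d :: "nat \<Rightarrow> nat"
  assumes d: "\<And>n. d n \<ge> 1" and small: "(\<lambda>n. real (d n)) \<in> o(\<lambda>n. ln (real n))"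
  defines "R \<equiv> \<lambda>n. sqrt (sqrt (ln (real n) / real (d n)))"
  shows "\<forall>\<^sub>F n in sequentially. R n > 0"
    and "(\<lambda>n. 7 / R n + 2 * R n * (3 ^ d n * 2 powr (real (d n) * ((R n)\<^sup>2 + 1))) / real n) \<longlonglongrightarrow> 0"
proof -
  define q where "q n = ln (real n) / real (d n)" for n
  have q: "filterlim q at_top sequentially"
  proof -
    have "(\<lambda>n. real (d n) / ln (real n)) \<longlonglongrightarrow> 0"
      using small by (rule smalloD_tendsto)
    moreover have "\<forall>\<^sub>F n in sequentially. 0 < real (d n) / ln (real n)"
      using eventually_gt_at_top[of 1]
    proof eventually_elim
      case (elim n)
      then show ?case
        using d[of n] by simp
    qed
    ultimately have "filterlim (\<lambda>n. inverse (real (d n) / ln (real n))) at_top sequentially"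
      by (intro filterlim_inverse_at_top)
    then show ?thesis
      by (simp add: q_def[abs_def])
  qed
  have R_eq: "R n = sqrt (sqrt (q n))" for n
    by (simp add: R_def q_def)
  have R: "filterlim R at_top sequentially"
    unfolding R_eq[abs_def] by (intro filterlim_compose[OF sqrt_at_top] q)
  show R_pos: "\<forall>\<^sub>F n in sequentially. R n > 0"
    using R by (simp add: filterlim_at_top_dense)
  have bound: "\<forall>\<^sub>F n in sequentially.
      2 * R n * (3 ^ d n * 2 powr (real (d n) * ((R n)\<^sup>2 + 1))) / real n \<le> 2 * (ln (real n) / real n powr (1 / 2))"
    \<comment> \<open>The threshold 4 for \<open>R n\<close> ensures \<open>quartic\<close> below,
      by which the exponent is at most half of \<open>ln n\<close>.\<close>
    using filterlim_at_top[THEN iffD1, OF R, rule_format, of 4] eventually_gt_at_top[of 1]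
  proof eventually_elim
    case (elim n)
    have dpos: "real (d n) \<ge> 1" and lnpos: "ln (real n) > 0"
      using d[of n] elim by auto
    have "q n > 0"
      using dpos lnpos by (simp add: q_def)
    have q_R: "q n = R n ^ 4"
    proof -
      have "R n ^ 4 = ((R n)\<^sup>2)\<^sup>2"
        by (simp flip: power_mult)
      then show ?thesis
        using \<open>q n > 0\<close> by (simp add: R_eq)
    qed
    have ln_eq: "ln (real n) = real (d n) * R n ^ 4"
      using dpos by (simp add: q_R[symmetric] q_def)
    have "R n \<le> R n ^ 4"
      using elim by (intro self_le_power) auto
    also have "\<dots> \<le> ln (real n)"
      unfolding ln_eq using dpos elim by (simp add: mult_le_cancel_right1)
    finally have R_le: "R n \<le> ln (real n)" .
    have quartic: "R n ^ 4 \<ge> 2 * ((R n)\<^sup>2 + 3)"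
    proof -
      have sq: "4 * 4 \<le> (R n)\<^sup>2"
        unfolding power2_eq_square using elim by (intro mult_mono) auto
      then have "16 * (R n)\<^sup>2 \<le> (R n)\<^sup>2 * (R n)\<^sup>2"
        by (intro mult_right_mono) auto
      also have "\<dots> = R n ^ 4"
        by (simp flip: power_add)
      finally show ?thesis
        using sq by simp
    qed
    \<comment> \<open>Raising 3 to 4 makes both factors powers of 2; this adds
      \<open>2 * d n\<close> to the exponent and explains the 3 in \<open>quartic\<close>.\<close>
    have "(3::real) ^ d n * 2 powr (real (d n) * ((R n)\<^sup>2 + 1))
        \<le> 4 ^ d n * 2 powr (real (d n) * ((R n)\<^sup>2 + 1))"
      by (intro mult_right_mono power_mono) auto
    also have "(4::real) ^ d n = 2 powr (real (d n) * 2)"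
      using powr_realpow[of 2 "2 * d n"] power_mult[of "2::real" 2 "d n"]
      by (simp add: mult.commute[of "real (d n)"])
    also have "\<dots> * 2 powr (real (d n) * ((R n)\<^sup>2 + 1)) = 2 powr (real (d n) * ((R n)\<^sup>2 + 3))"
      by (simp add: powr_add[symmetric] algebra_simps)
    also have "\<dots> \<le> 2 powr (ln (real n) / 2)"
    proof -
      have "real (d n) * (2 * ((R n)\<^sup>2 + 3)) \<le> real (d n) * R n ^ 4"
        using quartic by (intro mult_left_mono) auto
      then show ?thesis
        by (intro powr_mono) (auto simp: ln_eq algebra_simps)
    qed
    \<comment> \<open>Passing from base 2 to base e matches the natural logarithm, so the power
      becomes exactly the square root of \<open>n\<close>.\<close>
    also have "\<dots> \<le> exp 1 powr (ln (real n) / 2)"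
      using exp_ge_add_one_self[of 1] lnpos by (intro powr_mono2) auto
    also have "\<dots> = real n powr (1 / 2)"
      using elim by (simp add: powr_def)
    finally have N: "3 ^ d n * 2 powr (real (d n) * ((R n)\<^sup>2 + 1)) \<le> real n powr (1 / 2)" .
    have "2 * R n * (3 ^ d n * 2 powr (real (d n) * ((R n)\<^sup>2 + 1))) / real n
        \<le> 2 * ln (real n) * real n powr (1 / 2) / real n"
      using N R_le lnpos elim by (intro divide_right_mono mult_mono) auto
    also have "\<dots> = 2 * (ln (real n) / real n powr (1 / 2))"
    proof -
      have "real n = real n powr (1 / 2) * real n powr (1 / 2)"
        by (simp add: powr_add[symmetric])
      then show ?thesis
        using elim by (simp add: field_simps)
    qed
    finally show ?case .
  qed
  have "(\<lambda>n. 2 * (ln (real n) / real n powr (1 / 2))) \<longlonglongrightarrow> 2 * 0"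
    by (intro tendsto_intros lim_ln_over_power) auto
  then have "(\<lambda>n. 2 * R n * (3 ^ d n * 2 powr (real (d n) * ((R n)\<^sup>2 + 1))) / real n) \<longlonglongrightarrow> 0"
    by (intro tendsto_sandwich[OF eventually_mono[OF R_pos] bound tendsto_const]) auto
  moreover have "(\<lambda>n. 7 / R n) \<longlonglongrightarrow> 0"
    by (rule tendsto_divide_0[OF tendsto_const filterlim_at_top_imp_at_infinity[OF R]])
  ultimately show "(\<lambda>n. 7 / R n + 2 * R n * (3 ^ d n * 2 powr (real (d n) * ((R n)\<^sup>2 + 1))) / real n) \<longlonglongrightarrow> 0"
    using tendsto_add by fastforce
qed

section \<open>The standard basis as witness\<close>

theorem theorem6p2:
  fixes d :: "nat \<Rightarrow> nat"
  assumes "\<And>n. d n \<ge> 1"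
    and "(\<lambda>n. real (d n)) \<in> o(\<lambda>n. ln (real n))"
  shows "\<exists>(m :: nat \<Rightarrow> nat) (X :: nat \<Rightarrow> (nat \<Rightarrow> real) set) (\<delta> :: nat \<Rightarrow> real).
    (\<forall>\<^sub>F n in sequentially. X n \<subseteq> eucl_space (m n) \<and> finite (X n) \<and> card (X n) = n) \<and>
    (\<lambda>n. doubling_dimension (m n) (X n)) \<in> \<Theta>(\<lambda>n. ln (real n)) \<and>
    \<delta> \<longlonglongrightarrow> 0 \<and>
    (\<forall>\<^sub>F n in sequentially.
      measure (random_projection (d n) (m n))
        {G \<in> space (random_projection (d n) (m n)).
           mst_cost (d n) (mat_apply (d n) (m n) G ` X n) \<le> \<delta> n * mst_cost (m n) (X n)} \<ge> 2 / 3)"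
proof -
  define X where "X n = std_basis_vec n ` {..<n}" for n
  define R where "R n = sqrt (sqrt (ln (real n) / real (d n)))" for n
  define b where "b n = 7 / R n + 2 * R n * (3 ^ d n * 2 powr (real (d n) * ((R n)\<^sup>2 + 1))) / real n" for n
  \<comment> \<open>\<open>b n\<close> bounds the projected cost per point, and the original cost is
    at least \<open>n / sqrt 2\<close>; hence the factor \<open>sqrt 2\<close>.\<close>
  define \<delta> where "\<delta> n = sqrt 2 * b n" for n
  have R_pos: "\<forall>\<^sub>F n in sequentially. R n > 0" and b: "b \<longlonglongrightarrow> 0"
    using stretch_bound_tendsto_0[of d, OF assms] by (simp_all add: R_def b_def[abs_def])
  have X: "X n \<subseteq> eucl_space n" "finite (X n)" "card (X n) = n" for n
  proof -
    show "X n \<subseteq> eucl_space n"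
      unfolding X_def by (rule image_subsetI) (simp add: eucl_space_def std_basis_vec_def)
  qed (simp_all add: X_def card_image inj_on_std_basis_vec)
  have X_dist: "eucl_dist n x y = sqrt 2" if "x \<in> X n" "y \<in> X n" "x \<noteq> y" for n x y
    using that eucl_dist_std_basis_vec unfolding X_def by blast
  have "\<forall>\<^sub>F n in sequentially. doubling_dimension n (X n) = 1 / ln 2 * ln (real n)"
    using eventually_gt_at_top[of 0]
  proof eventually_elim
    case (elim n)
    then have "std_basis_vec n 0 \<in> X n"
      by (simp add: X_def)
    then have "doubling_constant n (X n) = n"
      using doubling_constant_equidistant[of "X n" _ "sqrt 2" n] X X_dist by simp
    then show ?case
      by (simp add: doubling_dimension_def log_def)
  qed
  then have "(\<lambda>n. doubling_dimension n (X n)) \<in> \<Theta>(\<lambda>n. 1 / ln 2 * ln (real n))"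
    by (rule bigthetaI_cong)
  then have dim: "(\<lambda>n. doubling_dimension n (X n)) \<in> \<Theta>(\<lambda>n. ln (real n))"
    by simp
  have "\<delta> \<longlonglongrightarrow> 0"
    unfolding \<delta>_def[abs_def] using tendsto_mult_left[OF b, of "sqrt 2"] by simp
  moreover have "\<forall>\<^sub>F n in sequentially. measure (random_projection (d n) n)
      {G \<in> space (random_projection (d n) n).
         mst_cost (d n) (mat_apply (d n) n G ` X n) \<le> \<delta> n * mst_cost n (X n)} \<ge> 2 / 3"
    \<comment> \<open>The lower bound on the cost of \<open>X n\<close> needs two points: a single
      vertex has no edge.\<close>
    using R_pos eventually_ge_at_top[of 2]
  proof eventually_elim
    case (elim n)
    let ?M = "random_projection (d n) n"
    let ?S = "\<lambda>G. \<Sum>i<n. \<Sum>k<d n. (G (k, i))\<^sup>2"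
    let ?E = "{G \<in> space ?M. mst_cost (d n) (mat_apply (d n) n G ` X n) \<le> \<delta> n * mst_cost n (X n)}"
    let ?B = "{G \<in> space ?M. ?S G \<ge> 3 * real n}"
    interpret prob_space ?M
      using assms(1) by (rule prob_space_random_projection)
    have "b n \<ge> 0"
      using elim by (simp add: b_def)
    have mst: "sqrt 2 * real n / 2 \<le> mst_cost n (X n)"
      using card_le_mst_cost[of "X n" "sqrt 2" n] X X_dist elim by simp
    have "b n * real n = \<delta> n * (sqrt 2 * real n / 2)"
      by (simp add: \<delta>_def)
    also have "\<dots> \<le> \<delta> n * mst_cost n (X n)"
      using mst \<open>b n \<ge> 0\<close> by (intro mult_left_mono) (auto simp: \<delta>_def)
    finally have b_le: "b n * real n \<le> \<delta> n * mst_cost n (X n)" .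
    \<comment> \<open>Randomness enters only through \<open>?B\<close>: off this event the cost
      bound is deterministic.\<close>
    have sub: "space ?M - ?B \<subseteq> ?E"
    proof
      fix G assume G: "G \<in> space ?M - ?B"
      have "mst_cost (d n) (mat_apply (d n) n G ` X n)
          \<le> 7 / R n * real n + 2 * R n * (3 ^ d n * 2 powr (real (d n) * ((R n)\<^sup>2 + 1)))"
        unfolding X_def using assms(1) elim G by (intro mst_cost_columns_le) auto
      also have "\<dots> = b n * real n"
        using elim by (simp add: b_def field_simps)
      finally show "G \<in> ?E"
        using b_le G by auto
    qed
    have "(\<lambda>G. \<Sum>j<n. G (k, j) * x j) \<in> borel_measurable ?M" if "k < d n" for k x
      using that by measurable
    moreover have "X n \<noteq> {}"
      using X(3)[of n] elim by force
    ultimately have "?E \<in> sets ?M"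
      using X by (intro sets_mst_cost_image_le) (auto simp: mat_apply_def)
    then have "prob (space ?M - ?B) \<le> prob ?E"
      using sub by (intro finite_measure_mono)
    moreover have "?B \<in> sets ?M"
      by measurable
    then have "prob (space ?M - ?B) = 1 - prob ?B"
      by (rule prob_compl)
    moreover have "prob ?B \<le> 1 / 3"
      using assms(1) elim by (intro prob_random_projection_square_sum_ge) auto
    ultimately show ?case
      by simp
  qed
  ultimately show ?thesis
    using X dim by (intro exI[of _ "\<lambda>n. n"] exI[of _ X] exI[of _ \<delta>]) simp
qed

end
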